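(* Let $\xi$ be started from an arbitrary fixed configuration $\xi_0=S_0\in\mathcal{D}$. (i) Suppose that $\beta\in[0,1]$ and $p\in[0,1]$. For any $\varepsilon>0$, $\mathbb{P}_{\beta,p}$-a.s., for all but finitely many $t\in\mathbb{Z}^+$, $$\max_{0\le s\le t}N(\xi_s)\le\begin{cases} t^{1/2}(\log t)^{(1/2)+\varepsilon}, & \text{if } p<1/2,\\ t^{1/3}(\log t)^{(1/3)+\varepsilon}, & \text{if } p\ge 1/2.\end{cases}$$ (ii) Suppose that $\beta\in[0,1]$ and $p\in[1/2,1]$. For any $\varepsilon>0$, $\mathbb{P}_{\beta,p}$-a.s., for all but finitely many $t\in\mathbb{Z}^+$, $$\max_{0\le s\le t}|\xi_s|\le t^{1/2}(\log t)^{(1/2)+\varepsilon}.$$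
   Context: Configurations: let $\mathcal{D}'\subset\{0,1\}^{\mathbb{Z}}$ be the set of configurations with finitely many $0$'s to the left of the origin and finitely many $1$'s to the right. Call $S,S'\in\mathcal{D}'$ equivalent if they are translates of each other, and let $\mathcal{D}$ be the (countable) set of equivalence classes. So each $S\in\mathcal{D}$ is an infinite string of $1$'s, followed by a finite string of $0$'s and $1$'s, followed by an infinite string of $0$'s, modulo translation. The ground state is $\mathcal{D}_0=\ldots 111000\ldots$ (up to translation). An unlike pair is a pair of adjacent sites with labels $01$ or $10$ (read left to right); each configuration has finitely many of them and at least one. Process: for $\beta,p\in[0,1]$ the discrete-time exclusion-voter process $\xi=(\xi_t)_{t\in\mathbb{Z}^+}$, $\mathbb{Z}^+=\{0,1,2,\ldots\}$, is the time-homogeneous Markov chain on $\mathcal{D}$ with the following one-step dynamics. At each time step, independently, a voter move is chosen with probability $\beta$ and an exclusion move with probability $1-\beta$; then one of the unlike pairs of the current configuration is chosen uniformly at random. In a voter move the chosen pair is replaced by $00$ or by $11$, each with probability $1/2$. In an exclusion move, a chosen pair $01$ becomes $10$ with probability $p$ (otherwise no change), and a chosen pair $10$ becomes $01$ with probability $1-p$ (otherwise no change). Its law is denoted $\mathbb{P}_{\beta,p}$. Block notation: a $1$-block ($0$-block) is a maximal string of consecutive $1$'s ($0$'s). $N(S)\ge0$ is the number of $1$-blocks of $S$ not counting the infinite $1$-block on the left (equivalently, the number of $0$-blocks not counting the infinite $0$-block on the right). For $S\ne\mathcal{D}_0$, enumerating left to right, $n_i$ is the size of the $i$th finite $0$-block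 and $m_i$ the size of the $i$th finite $1$-block, $1\le i\le N(S)$. The size of the hybrid zone is $|S|=\sum_{i=1}^{N(S)}(n_i+m_i)$, and $|\mathcal{D}_0|=0$. *)

theory Defs
  imports "HOL-Probability.Probability"
begin

text \<open>Labels are Booleans: \<open>True\<close> stands for $1$ and \<open>False\<close> for $0$.\<close>

type_synonym labelling = "int \<Rightarrow> bool"

definition admissible :: "labelling \<Rightarrow> bool" where
  "admissible S \<longleftrightarrow> finite {x. x < 0 \<and> \<not> S x} \<and> finite {x. 0 < x \<and> S x}"

definition translates :: "labelling \<Rightarrow> labelling \<Rightarrow> bool" where
  "translates S S' \<longleftrightarrow> admissible S \<and> admissible S' \<and> (\<exists>k. \<forall>x. S' x = S (x + k))"

lemma part_equivp_translates: "part_equivp translates"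
proof (rule part_equivpI)
  have "{x::int. x < 0 \<and> \<not> x \<le> 0} = {}" and "{x::int. 0 < x \<and> x \<le> 0} = {}"
    by auto
  then have "admissible (\<lambda>x. x \<le> 0)"
    unfolding admissible_def by (simp only: finite.emptyI simp_thms)
  then show "\<exists>S. translates S S"
    unfolding translates_def by (metis add_0_right)
  show "symp translates"
  proof (rule sympI)
    fix S S' assume "translates S S'"
    then obtain k where "admissible S" "admissible S'" "\<And>x. S' x = S (x + k)"
      by (auto simp: translates_def)
    then have "admissible S' \<and> admissible S \<and> (\<forall>x. S x = S' (x + (- k)))"
      by simp
    then show "translates S' S"
      unfolding translates_def by blast
  qed
  show "transp translates"
  proof (rule transpI)
    fix S S' S'' assume "translates S S'" "translates S' S''"
    then obtain k l where "admissible S" "admissible S''"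
      "\<And>x. S' x = S (x + k)" "\<And>x. S'' x = S' (x + l)"
      by (auto simp: translates_def)
    then have "admissible S \<and> admissible S'' \<and> (\<forall>x. S'' x = S (x + (l + k)))"
      by (simp add: add.assoc)
    then show "translates S S''"
      unfolding translates_def by blast
  qed
qed

quotient_type config = labelling / partial: translates
  by (rule part_equivp_translates)


text \<open>An unlike pair is identified with its left site.\<close>

definition unlike_pairs :: "labelling \<Rightarrow> int set" where
  "unlike_pairs S = {x. S x \<noteq> S (x + 1)}"

definition voter_move :: "labelling \<Rightarrow> int \<Rightarrow> labelling pmf" where
  "voter_move S x = map_pmf (\<lambda>b. S(x := b, x + 1 := b)) (bernoulli_pmf (1/2))"

definition exclusion_move :: "real \<Rightarrow> labelling \<Rightarrow> int \<Rightarrow> labelling pmf" where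
  "exclusion_move p S x =
     (if S x
      then map_pmf (\<lambda>b. if b then S(x := False, x + 1 := True) else S) (bernoulli_pmf (1 - p))
      else map_pmf (\<lambda>b. if b then S(x := True, x + 1 := False) else S) (bernoulli_pmf p))"

definition labelling_step :: "real \<Rightarrow> real \<Rightarrow> labelling \<Rightarrow> labelling pmf" where
  "labelling_step \<beta> p S =
     bind_pmf (bernoulli_pmf \<beta>) (\<lambda>voter.
     bind_pmf (pmf_of_set (unlike_pairs S)) (\<lambda>x.
       if voter then voter_move S x else exclusion_move p S x))"

lemma admissible_bounds:
  assumes "admissible S"
  obtains a b where "a \<le> b" "\<And>x. x < a \<Longrightarrow> S x" "\<And>x. b < x \<Longrightarrow> \<not> S x"
proof -
  have "finite {x. x < 0 \<and> \<not> S x}" "finite {x. 0 < x \<and> S x}"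
    using assms by (auto simp: admissible_def)
  then have "bdd_below {x. x < 0 \<and> \<not> S x}" "bdd_above {x. 0 < x \<and> S x}"
    by auto
  then obtain a b where a: "\<And>x. x < 0 \<Longrightarrow> \<not> S x \<Longrightarrow> a \<le> x" and b: "\<And>x. 0 < x \<Longrightarrow> S x \<Longrightarrow> x \<le> b"
    unfolding bdd_below_def bdd_above_def by blast
  show ?thesis
  proof (rule that)
    show "min a 0 \<le> max b 0" by linarith
    show "S x" if "x < min a 0" for x
      using a[of x] that by linarith
    show "\<not> S x" if "max b 0 < x" for x
      using b[of x] that by linarith
  qed
qed

lemma finite_unlike_pairs:
  assumes "admissible S" shows "finite (unlike_pairs S)"
proof -
  obtain a b where ab: "\<And>x. x < a \<Longrightarrow> S x" "\<And>x. b < x \<Longrightarrow> \<not> S x"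
    using admissible_bounds[OF assms] by metis
  have "x \<in> {a - 1..b}" if "x \<in> unlike_pairs S" for x
  proof (rule ccontr)
    assume "x \<notin> {a - 1..b}"
    then have "x + 1 < a \<or> b < x" by auto
    then have "S x = S (x + 1)"
      using ab[of x] ab[of "x + 1"] by auto
    with that show False by (simp add: unlike_pairs_def)
  qed
  then have "unlike_pairs S \<subseteq> {a - 1..b}" by blast
  then show ?thesis by (rule finite_subset) simp
qed

lemma unlike_pairs_nonempty:
  assumes "admissible S" shows "unlike_pairs S \<noteq> {}"
proof
  assume *: "unlike_pairs S = {}"
  obtain a b where ab: "a \<le> b" "\<And>x. x < a \<Longrightarrow> S x" "\<And>x. b < x \<Longrightarrow> \<not> S x"
    using admissible_bounds[OF assms] by metis
  have "S (a - 1 + int n)" for n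
  proof (induction n)
    case (Suc n)
    have "a - 1 + int n \<notin> unlike_pairs S" using * by simp
    with Suc show ?case by (simp add: unlike_pairs_def algebra_simps)
  next
    case 0
    show ?case using ab(2)[of "a - 1"] by simp
  qed
  moreover have "b < a - 1 + int (nat (b - a + 2))"
    using ab(1) by simp
  ultimately show False using ab(3) by blast
qed

lemma admissible_upd:
  assumes "admissible S" shows "admissible (S(x := b))"
proof -
  have "{y. y < 0 \<and> \<not> (S(x := b)) y} \<subseteq> insert x {y. y < 0 \<and> \<not> S y}"
    and "{y. 0 < y \<and> (S(x := b)) y} \<subseteq> insert x {y. 0 < y \<and> S y}"
    by (auto split: if_splits)
  then show ?thesis
    using assms unfolding admissible_def by (meson finite_insert finite_subset)
qed

lemma admissible_labelling_step:
  assumes "admissible S" "S' \<in> set_pmf (labelling_step \<beta> p S)"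
  shows "admissible S'"
proof -
  obtain x where "S' \<in> set_pmf (voter_move S x) \<or> S' \<in> set_pmf (exclusion_move p S x)"
    using assms(2) unfolding labelling_step_def set_bind_pmf by (auto simp only: UN_iff split: if_splits)
  then obtain b c where "S' = S(x := b, x + 1 := c) \<or> S' = S"
    unfolding voter_move_def exclusion_move_def
    by (auto simp only: set_map_pmf image_iff split: if_splits)
  then show ?thesis
    using assms(1) by (auto simp only: admissible_upd)
qed

lemma labelling_step_shift:
  assumes "admissible S"
  shows "labelling_step \<beta> p (\<lambda>x. S (x + k)) = map_pmf (\<lambda>T x. T (x + k)) (labelling_step \<beta> p S)"
proof -
  let ?S = "\<lambda>x. S (x + k)"
  have U: "unlike_pairs ?S = (\<lambda>x. x - k) ` unlike_pairs S"
  proof (rule set_eqI)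
    fix x
    have "x \<in> (\<lambda>x. x - k) ` unlike_pairs S \<longleftrightarrow> x + k \<in> unlike_pairs S"
      by (auto simp: image_iff intro: bexI[of _ "x + k"])
    also have "\<dots> \<longleftrightarrow> x \<in> unlike_pairs ?S"
      by (simp add: unlike_pairs_def add.assoc add.commute[of 1 k])
    finally show "x \<in> unlike_pairs ?S \<longleftrightarrow> x \<in> (\<lambda>x. x - k) ` unlike_pairs S" ..
  qed
  have P: "pmf_of_set (unlike_pairs ?S) = map_pmf (\<lambda>x. x - k) (pmf_of_set (unlike_pairs S))"
    unfolding U using assms
    by (subst map_pmf_of_set_inj) (auto simp: finite_unlike_pairs unlike_pairs_nonempty inj_on_def)
  have upd: "?S(x - k := b, x - k + 1 := c) = (\<lambda>y. (S(x := b, x + 1 := c)) (y + k))" for x b c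
    by (auto simp: fun_eq_iff)
  have V: "voter_move ?S (x - k) = map_pmf (\<lambda>T y. T (y + k)) (voter_move S x)" for x
    unfolding voter_move_def map_pmf_comp upd ..
  have E: "exclusion_move p ?S (x - k) = map_pmf (\<lambda>T y. T (y + k)) (exclusion_move p S x)" for x
    unfolding exclusion_move_def upd map_pmf_comp if_distrib[of "map_pmf (\<lambda>T y. T (y + k))"]
    by (simp only: diff_add_cancel if_distrib[of "\<lambda>T y. T (y + k)"])
  show ?thesis
    unfolding labelling_step_def P bind_map_pmf map_bind_pmf V E
      if_distrib[of "map_pmf (\<lambda>T x. T (x + k))"] ..
qed

lift_definition step :: "real \<Rightarrow> real \<Rightarrow> config \<Rightarrow> config pmf" is labelling_step
proof -
  fix \<beta> p S S' assume "translates S S'"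
  then obtain k where S: "admissible S" and S': "S' = (\<lambda>x. S (x + k))" "admissible S'"
    by (auto simp: translates_def fun_eq_iff)
  have "translates T (\<lambda>x. T (x + k))" if T: "T \<in> set_pmf (labelling_step \<beta> p S)" for T
  proof -
    have "(\<lambda>x. T (x + k)) \<in> set_pmf (labelling_step \<beta> p S')"
      using T unfolding S'(1) labelling_step_shift[OF S, of \<beta> p k] by simp
    then show ?thesis
      using admissible_labelling_step T S S'(2) unfolding translates_def by blast
  qed
  then show "rel_pmf translates (labelling_step \<beta> p S) (labelling_step \<beta> p S')"
    unfolding S' labelling_step_shift[OF S, of \<beta> p k] pmf.rel_map
    by (intro rel_pmf_reflI)
qed


definition strings :: "bool \<Rightarrow> labelling \<Rightarrow> int set set" where
  "strings v S = {B. B \<noteq> {} \<and> (\<forall>x\<in>B. S x = v) \<and> (\<forall>x\<in>B. \<forall>y\<in>B. {x..y} \<subseteq> B)}"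

definition blocks :: "bool \<Rightarrow> labelling \<Rightarrow> int set set" where
  "blocks v S = {B \<in> strings v S. \<forall>C\<in>strings v S. B \<subseteq> C \<longrightarrow> C = B}"

text \<open>For admissible \<open>S\<close>, finiteness excludes exactly the infinite \<open>1\<close>-block on the left and
  the infinite \<open>0\<close>-block on the right.\<close>

definition finite_blocks :: "bool \<Rightarrow> labelling \<Rightarrow> int set set" where
  "finite_blocks v S = {B \<in> blocks v S. finite B}"

lemma inj_shift: "inj (\<lambda>x::int. x - k)"
  by (rule injI) simp

lemma Ball_image: "(\<forall>y\<in>h ` A. P y) \<longleftrightarrow> (\<forall>x\<in>A. P (h x))"
  by blast

lemma shift_mem_strings:
  "(\<lambda>x. x - k) ` B \<in> strings v (\<lambda>x. S (x + k)) \<longleftrightarrow> B \<in> strings v S"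
proof -
  have "{x - k..y - k} = (\<lambda>x. x - k) ` {x..y}" for x y
  proof (rule set_eqI)
    fix z
    have "z \<in> (\<lambda>x. x - k) ` {x..y} \<longleftrightarrow> z + k \<in> {x..y}"
      by (auto simp: image_iff intro: bexI[of _ "z + k"])
    then show "z \<in> {x - k..y - k} \<longleftrightarrow> z \<in> (\<lambda>x. x - k) ` {x..y}"
      by auto
  qed
  then have "{x - k..y - k} \<subseteq> (\<lambda>x. x - k) ` B \<longleftrightarrow> {x..y} \<subseteq> B" for x y
    by (simp only: inj_image_subset_iff[OF inj_shift])
  then show ?thesis
    unfolding strings_def mem_Collect_eq Ball_image image_is_empty diff_add_cancel by simp
qed

lemma strings_shift: "strings v (\<lambda>x. S (x + k)) = (\<lambda>B. (\<lambda>x. x - k) ` B) ` strings v S"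
proof (rule set_eqI)
  fix B :: "int set"
  have B: "(\<lambda>x. x - k) ` (\<lambda>x. x + k) ` B = B"
    by (simp add: image_image)
  have "B \<in> strings v (\<lambda>x. S (x + k)) \<longleftrightarrow> (\<lambda>x. x + k) ` B \<in> strings v S"
    using shift_mem_strings[of k "(\<lambda>x. x + k) ` B" v S] unfolding B .
  also have "\<dots> \<longleftrightarrow> (\<exists>C\<in>strings v S. B = (\<lambda>x. x - k) ` C)"
  proof
    assume "(\<lambda>x. x + k) ` B \<in> strings v S"
    then show "\<exists>C\<in>strings v S. B = (\<lambda>x. x - k) ` C"
      using B[symmetric] by (rule bexI[rotated])
  qed (auto simp: image_image)
  finally show "B \<in> strings v (\<lambda>x. S (x + k)) \<longleftrightarrow> B \<in> (\<lambda>B. (\<lambda>x. x - k) ` B) ` strings v S"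
    by (simp only: image_iff)
qed

lemma Collect_mem_image: "{y \<in> h ` A. P y} = h ` {x \<in> A. P (h x)}"
  by blast

lemma blocks_shift: "blocks v (\<lambda>x. S (x + k)) = (\<lambda>B. (\<lambda>x. x - k) ` B) ` blocks v S"
  unfolding blocks_def strings_shift[of v S k] Collect_mem_image Ball_image
    inj_image_subset_iff[OF inj_shift] inj_image_eq_iff[OF inj_shift] ..

lemma finite_blocks_shift:
  "finite_blocks v (\<lambda>x. S (x + k)) = (\<lambda>B. (\<lambda>x. x - k) ` B) ` finite_blocks v S"
  unfolding finite_blocks_def blocks_shift[of v S k] Collect_mem_image
    finite_image_iff[OF inj_on_subset[OF inj_shift subset_UNIV]] ..

lemma inj_shift_set: "inj_on (\<lambda>B. (\<lambda>x. x - k) ` B) (A :: int set set)"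
  by (rule inj_onI) (simp only: inj_image_eq_iff[OF inj_shift])

lift_definition num_blocks :: "config \<Rightarrow> nat" is "\<lambda>S. card (finite_blocks True S)"
proof -
  fix S S' assume "translates S S'"
  then obtain k where S': "S' = (\<lambda>x. S (x + k))"
    by (auto simp: translates_def fun_eq_iff)
  show "card (finite_blocks True S) = card (finite_blocks True S')"
    unfolding S' finite_blocks_shift[of True S k] by (rule card_image[OF inj_shift_set, symmetric])
qed

lift_definition zone_size :: "config \<Rightarrow> nat" is
  "\<lambda>S. (\<Sum>B\<in>finite_blocks False S. card B) + (\<Sum>B\<in>finite_blocks True S. card B)"
proof -
  fix S S' assume "translates S S'"
  then obtain k where S': "S' = (\<lambda>x. S (x + k))"
    by (auto simp: translates_def fun_eq_iff)
  have "(\<Sum>B\<in>finite_blocks v S'. card B) = (\<Sum>B\<in>finite_blocks v S. card B)" for v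
    unfolding S' finite_blocks_shift[of v S k]
    by (subst sum.reindex[OF inj_shift_set]) (simp add: card_image inj_on_def)
  then show "(\<Sum>B\<in>finite_blocks False S. card B) + (\<Sum>B\<in>finite_blocks True S. card B) =
      (\<Sum>B\<in>finite_blocks False S'. card B) + (\<Sum>B\<in>finite_blocks True S'. card B)"
    by simp
qed


text \<open>The Markov property is stated in product form, so that conditioning on null events
  needs no special treatment.\<close>

locale exclusion_voter_process = prob_space M
  for M :: "'w measure" and \<beta> p :: real and S\<^sub>0 :: config and \<xi> :: "nat \<Rightarrow> 'w \<Rightarrow> config" +
  assumes random_variable_\<xi>: "\<And>t. random_variable (count_space UNIV) (\<xi> t)"
    and initial: "AE \<omega> in M. \<xi> 0 \<omega> = S\<^sub>0"
    and markov: "\<And>t s. prob {\<omega> \<in> space M. \<forall>i\<le>Suc t. \<xi> i \<omega> = s i} =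
      prob {\<omega> \<in> space M. \<forall>i\<le>t. \<xi> i \<omega> = s i} * pmf (step \<beta> p (s t)) (s (Suc t))"

end

theory Submission
  imports Defs
begin

text \<open>
  Call a pair of sites \<open>i < j\<close> an inversion of a configuration if \<open>i\<close> carries a \<open>0\<close> and \<open>j\<close> a \<open>1\<close>.
  The proof rests on two Lyapunov functions: the number of inversions (\<open>inversion_count\<close>) and
  the sum \<open>\<Sum>(j - i)\<close> of their lengths (\<open>inversion_length\<close>). Both are instances of the sum
  \<open>potential w\<close> of weights \<open>w (j - i)\<close>, whose mean change under a single move is computed
  for all weights at once (\<open>expectation_move\<close>).

  The mean one-step increase of \<open>inversion_count\<close> is at most \<open>1\<close> for all \<open>\<beta>\<close> and \<open>p\<close>, because an
  exclusion move changes it by at most one and voter moves do not increase its mean. The mean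
  increase of \<open>inversion_length\<close> is at most \<open>1\<close> when \<open>p \<ge> 1/2\<close>. Here single moves have large
  effects, but a summation by parts over the unlike pairs (\<open>unlike_pairs_balance\<close>) shows that
  the effects of voter moves cancel, and that those of exclusion moves cancel at \<open>p = 1/2\<close> up
  to a bounded term; for larger \<open>p\<close> the favoured exclusion moves are those that shorten inversions.

  On the other hand, with \<open>N\<close> finite \<open>1\<close>-blocks there are at least \<open>N\<^sup>2 / 2\<close> inversions, and their
  total length is at least \<open>N ^ 3 / 6\<close>; it is also at least \<open>L\<^sup>2 / 8\<close> for a hybrid zone of
  size \<open>L\<close>. These three bounds give the exponents \<open>1/2\<close>, \<open>1/3\<close> and \<open>1/2\<close>.

  The probabilistic input is general (\<open>AE_running_max_le\<close>): if a nonnegative function of a Markov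
  chain has mean increments bounded by a constant and dominates a multiple of \<open>g ^ k\<close>, then a
  maximal inequality and the Borel--Cantelli lemma along dyadic times show that the running
  maximum of \<open>g\<close> is almost surely at most \<open>t powr (1/k) * (ln t) powr (1/k + \<epsilon>)\<close> eventually.
\<close>

section \<open>Growth of Lyapunov functions along a Markov chain\<close>

text \<open>Paths are recorded with the latest state first, so that the head of the list is the state from
  which the next step is taken.\<close>

primrec path_law :: "('s \<Rightarrow> 's pmf) \<Rightarrow> 's \<Rightarrow> nat \<Rightarrow> 's list pmf" where
  "path_law K s 0 = return_pmf [s]"
| "path_law K s (Suc t) = bind_pmf (path_law K s t) (\<lambda>l. map_pmf (\<lambda>x. x # l) (K (hd l)))"

lemma length_path_law: "l \<in> set_pmf (path_law K s t) \<Longrightarrow> length l = Suc t"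
  by (induction t arbitrary: l) auto

lemma pmf_path_law_Cons:
  "pmf (path_law K s (Suc t)) (x # l) = pmf (path_law K s t) l * pmf (K (hd l)) x"
proof -
  have "pmf (map_pmf (\<lambda>x. x # l') (K (hd l'))) (x # l) = indicator {l} l' * pmf (K (hd l)) x" for l'
  proof (cases "l' = l")
    case True
    have "pmf (map_pmf (\<lambda>x. x # l) (K (hd l))) (x # l) = pmf (K (hd l)) x"
      by (rule pmf_map_inj') (simp add: inj_def)
    with True show ?thesis by simp
  next
    case False
    then have "x # l \<notin> (\<lambda>x. x # l') ` set_pmf (K (hd l'))" by auto
    with False show ?thesis
      by (simp add: pmf_map_outside)
  qed
  then show ?thesis
    by (simp add: pmf_bind measure_pmf_single)
qed

text \<open>Freeze the path when \<open>f\<close> first reaches the level \<open>a\<close>, and from then on count the value \<open>a\<close>.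
  The mean of this stopped value still grows by at most \<open>C\<close> per step, and Markov's inequality at
  time \<open>t\<close> bounds the probability of having been stopped.\<close>

lemma path_law_maximal_inequality:
  fixes K :: "'s \<Rightarrow> 's pmf" and f :: "'s \<Rightarrow> ennreal"
  assumes drift: "\<And>s. (\<integral>\<^sup>+y. f y \<partial>K s) \<le> f s + C"
  shows "a * emeasure (path_law K s t) {l. \<exists>x\<in>set l. a \<le> f x} \<le> f s + of_nat t * C"
proof -
  define stopped where "stopped l = (if \<exists>x\<in>set l. a \<le> f x then a else f (hd l))" for l
  have step: "(\<integral>\<^sup>+x. stopped (x # l) \<partial>K (hd l)) \<le> stopped l + C" for l
  proof (cases "\<exists>x\<in>set l. a \<le> f x")
    case True
    then show ?thesis by (auto simp: stopped_def measure_pmf.emeasure_space_1)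
  next
    case False
    \<comment> \<open>If the new state reaches the level, then \<open>a\<close> is at most its \<open>f\<close>-value.\<close>
    have "(\<integral>\<^sup>+x. stopped (x # l) \<partial>K (hd l)) \<le> (\<integral>\<^sup>+x. f x \<partial>K (hd l))"
      using False by (intro nn_integral_mono) (auto simp: stopped_def)
    also have "\<dots> \<le> f (hd l) + C" by (rule drift)
    finally show ?thesis using False by (simp add: stopped_def)
  qed
  have "(\<integral>\<^sup>+l. stopped l \<partial>path_law K s t) \<le> f s + of_nat t * C"
  proof (induction t)
    case 0
    show ?case by (simp add: stopped_def nn_integral_return_pmf)
  next
    case (Suc t)
    have "(\<integral>\<^sup>+l. stopped l \<partial>path_law K s (Suc t))
        = (\<integral>\<^sup>+l. (\<integral>\<^sup>+x. stopped (x # l) \<partial>K (hd l)) \<partial>path_law K s t)"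
      by (simp add: nn_integral_bind_pmf nn_integral_map_pmf)
    also have "\<dots> \<le> (\<integral>\<^sup>+l. stopped l + C \<partial>path_law K s t)"
      by (intro nn_integral_mono step)
    also have "\<dots> = (\<integral>\<^sup>+l. stopped l \<partial>path_law K s t) + C"
      by (simp add: nn_integral_add measure_pmf.emeasure_space_1)
    also have "\<dots> \<le> f s + of_nat t * C + C"
      by (intro add_right_mono Suc)
    finally show ?case by (simp add: algebra_simps)
  qed
  moreover have "a * emeasure (path_law K s t) {l. \<exists>x\<in>set l. a \<le> f x}
      = (\<integral>\<^sup>+l. a * indicator {l. \<exists>x\<in>set l. a \<le> f x} l \<partial>path_law K s t)"
    by (simp add: nn_integral_cmult_indicator)
  moreover have "\<dots> \<le> (\<integral>\<^sup>+l. stopped l \<partial>path_law K s t)"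
    by (intro nn_integral_mono) (auto simp: stopped_def indicator_def)
  ultimately show ?thesis by simp
qed

locale countable_markov_chain = prob_space M
  for M :: "'w measure" and K :: "'s::countable \<Rightarrow> 's pmf" and s\<^sub>0 :: 's and X :: "nat \<Rightarrow> 'w \<Rightarrow> 's" +
  assumes measurable_X [measurable]: "\<And>t. X t \<in> measurable M (count_space UNIV)"
    and start: "AE \<omega> in M. X 0 \<omega> = s\<^sub>0"
    and chain: "\<And>t s. prob {\<omega> \<in> space M. \<forall>i\<le>Suc t. X i \<omega> = s i} =
      prob {\<omega> \<in> space M. \<forall>i\<le>t. X i \<omega> = s i} * pmf (K (s t)) (s (Suc t))"
begin

primrec path :: "nat \<Rightarrow> 'w \<Rightarrow> 's list" where
  "path 0 \<omega> = [X 0 \<omega>]"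
| "path (Suc t) \<omega> = X (Suc t) \<omega> # path t \<omega>"

lemma set_path: "set (path t \<omega>) = (\<lambda>i. X i \<omega>) ` {..t}"
  by (induction t) (auto simp: atMost_Suc)

lemma length_path: "length (path t \<omega>) = Suc t"
  by (induction t) auto

lemma path_eq_iff:
  assumes "length l = Suc t"
  shows "path t \<omega> = l \<longleftrightarrow> (\<forall>i\<le>t. X i \<omega> = l ! (t - i))"
  using assms
proof (induction t arbitrary: l)
  case 0
  then show ?case by (cases l) auto
next
  case (Suc t)
  then obtain x l' where l: "l = x # l'" "length l' = Suc t" by (cases l) auto
  show ?case
    unfolding l path.simps list.inject Suc.IH[OF l(2)]
    by (auto simp: le_Suc_eq Suc_diff_le)
qed

text \<open>The product form of the Markov property is exactly the recursion for the point masses of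
  \<open>path_law\<close>, and a law on the countable set of paths is determined by its point masses.\<close>

lemma prob_path_eq: "prob {\<omega> \<in> space M. path t \<omega> = l} = pmf (path_law K s\<^sub>0 t) l"
proof (cases "length l = Suc t")
  case False
  then have 1: "l \<notin> set_pmf (path_law K s\<^sub>0 t)" and 2: "{\<omega> \<in> space M. path t \<omega> = l} = {}"
    using length_path_law[of l K s\<^sub>0 t] length_path[of t] by auto
  show ?thesis unfolding 2 using 1 by (simp add: set_pmf_iff)
next
  case True
  then show ?thesis
  proof (induction t arbitrary: l)
    case 0
    then obtain x where l: "l = [x]" by (cases l) auto
    have "prob {\<omega> \<in> space M. X 0 \<omega> = x} = (if x = s\<^sub>0 then 1 else 0)"
    proof (cases "x = s\<^sub>0")
      case True
      then have "prob {\<omega> \<in> space M. X 0 \<omega> = x} = 1"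
        using start by (subst prob_Collect_eq_1) auto
      with True show ?thesis by simp
    next
      case False
      have "AE \<omega> in M. X 0 \<omega> \<noteq> x" using start False by auto
      then have "prob {\<omega> \<in> space M. X 0 \<omega> = x} = 0"
        by (subst prob_Collect_eq_0) auto
      with False show ?thesis by simp
    qed
    then show ?case using l by (simp add: pmf_return)
  next
    case (Suc t)
    then obtain x l' where l: "l = x # l'" "length l' = Suc t" by (cases l) auto
    have "{\<omega> \<in> space M. path (Suc t) \<omega> = l} = {\<omega> \<in> space M. \<forall>i\<le>Suc t. X i \<omega> = l ! (Suc t - i)}"
      by (simp only: path_eq_iff[OF Suc.prems])
    moreover have "{\<omega> \<in> space M. path t \<omega> = l'} = {\<omega> \<in> space M. \<forall>i\<le>t. X i \<omega> = l ! (Suc t - i)}"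
      unfolding path_eq_iff[OF l(2)] using l by (auto simp: Suc_diff_le)
    moreover have "l ! (Suc t - t) = hd l'" "l ! (Suc t - Suc t) = x"
      using l by (cases l'; simp)+
    ultimately show ?case
      using chain[of t "\<lambda>i. l ! (Suc t - i)"] Suc.IH[OF l(2)]
      by (simp only: l(1) pmf_path_law_Cons)
  qed
qed

lemma measurable_path [measurable]: "path t \<in> measurable M (count_space UNIV)"
  by (induction t) (auto intro: measurable_compose_countable)

lemma distr_path: "distr M (count_space UNIV) (path t) = measure_pmf (path_law K s\<^sub>0 t)"
proof (rule measure_eqI_countable[where A = UNIV])
  fix l
  have "emeasure (distr M (count_space UNIV) (path t)) {l} = emeasure M {\<omega> \<in> space M. path t \<omega> = l}"
    by (subst emeasure_distr) (auto intro!: arg_cong[where f = "emeasure M"])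
  then show "emeasure (distr M (count_space UNIV) (path t)) {l} = emeasure (path_law K s\<^sub>0 t) {l}"
    by (simp add: emeasure_eq_measure prob_path_eq emeasure_pmf_single)
qed auto

lemma maximal_inequality:
  assumes f: "\<And>s. 0 \<le> f s" and C: "0 \<le> C"
    and drift: "\<And>s. (\<integral>\<^sup>+y. ennreal (f y) \<partial>K s) \<le> ennreal (f s + C)"
    and a: "0 < a"
  shows "prob {\<omega> \<in> space M. \<exists>i\<le>t. a \<le> f (X i \<omega>)} \<le> (f s\<^sub>0 + real t * C) / a"
proof -
  let ?A = "{l. \<exists>x\<in>set l. ennreal a \<le> ennreal (f x)}"
  have "emeasure (path_law K s\<^sub>0 t) ?A = emeasure M {\<omega> \<in> space M. \<exists>i\<le>t. a \<le> f (X i \<omega>)}"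
    unfolding distr_path[symmetric]
    by (subst emeasure_distr)
       (auto intro!: arg_cong[where f = "emeasure M"] simp: set_path ennreal_le_iff f)
  moreover have "ennreal a * emeasure (path_law K s\<^sub>0 t) ?A \<le> ennreal (f s\<^sub>0) + of_nat t * ennreal C"
    using drift by (intro path_law_maximal_inequality) (simp add: f C)
  ultimately have "ennreal (a * prob {\<omega> \<in> space M. \<exists>i\<le>t. a \<le> f (X i \<omega>)}) \<le> ennreal (f s\<^sub>0 + real t * C)"
    using a by (simp add: emeasure_eq_measure ennreal_mult f C ennreal_of_nat_eq_real_of_nat)
  then have "a * prob {\<omega> \<in> space M. \<exists>i\<le>t. a \<le> f (X i \<omega>)} \<le> f s\<^sub>0 + real t * C"
    by (subst (asm) ennreal_le_iff) (simp_all add: f C)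
  then show ?thesis using a by (simp add: field_simps)
qed

text \<open>Borel--Cantelli along the dyadic times: with \<open>h u = u powr (1/k) * ln u powr (1/k + \<epsilon>)\<close>, let
  \<open>B n\<close> be the event that \<open>g\<close> exceeds \<open>h (2 ^ n)\<close> by time \<open>2 ^ (n + 1)\<close>. It forces \<open>f\<close> above a
  level of order \<open>2 ^ n * n powr (1 + k * \<epsilon>)\<close>, while the mean of \<open>f\<close> grows only to order \<open>2 ^ n\<close>
  by then, so the maximal inequality gives a summable bound. Comparing with \<open>h\<close> at the \<^emph>\<open>left\<close> end
  of the dyadic interval lets monotonicity of \<open>h\<close> fill in the remaining times without losing
  a constant.\<close>

lemma AE_running_max_le:
  fixes f :: "'s \<Rightarrow> real" and g :: "'s \<Rightarrow> nat" and k :: nat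
  assumes f: "\<And>s. 0 \<le> f s" and C: "0 \<le> C"
    and drift: "\<And>s. (\<integral>\<^sup>+y. ennreal (f y) \<partial>K s) \<le> ennreal (f s + C)"
    and c: "0 < c" and dom: "\<And>s. c * real (g s) ^ k \<le> f s" and k: "0 < k" and eps: "0 < \<epsilon>"
  shows "AE \<omega> in M. \<forall>\<^sub>\<infinity>t. real (MAX s\<in>{0..t}. g (X s \<omega>)) \<le>
    real t powr (1 / real k) * ln (real t) powr (1 / real k + \<epsilon>)"
proof -
  define h where "h u = u powr (1 / real k) * ln u powr (1 / real k + \<epsilon>)" for u :: real
  define q where "q = 1 + real k * \<epsilon>"
  have q: "1 < q" using k eps by (simp add: q_def)
  have h_mono: "h u \<le> h v" if "1 \<le> u" "u \<le> v" for u v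
    unfolding h_def using that eps by (intro mult_mono powr_mono2) auto
  define B where "B n = {\<omega> \<in> space M. \<exists>i\<le>2 ^ Suc n. h (2 ^ n) < real (g (X i \<omega>))}" for n
  have B_sets [measurable]: "B n \<in> sets M" for n
    unfolding B_def by measurable
  define c' where "c' = (f s\<^sub>0 + 2 * C) / (c * ln 2 powr q)"
  have prob_B: "prob (B n) \<le> c' * real n powr (- q)" if n: "1 \<le> n" for n
  proof -
    define a where "a = c * (2 ^ n * (real n * ln 2) powr q)"
    have a_pos: "0 < a" using c n by (simp add: a_def)
    \<comment> \<open>The exponent \<open>1 + k * \<epsilon>\<close> of the logarithm is what makes the bounds summable.\<close>
    have h_pow: "c * h (2 ^ n) ^ k = a"
    proof -
      have "h (2 ^ n) = (2 ^ n) powr (1 / real k) * (real n * ln 2) powr (1 / real k + \<epsilon>)"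
        by (simp add: h_def ln_realpow)
      then have "h (2 ^ n) ^ k = ((2 ^ n) powr (1 / real k)) powr k * ((real n * ln 2) powr (1 / real k + \<epsilon>)) powr k"
        using n by (simp add: power_mult_distrib powr_realpow)
      also have "\<dots> = 2 ^ n * (real n * ln 2) powr q"
      proof -
        have "(1 / real k + \<epsilon>) * real k = q" "1 / real k * real k = 1"
          using k by (simp_all add: q_def field_simps)
        then show ?thesis by (simp only: powr_powr) simp
      qed
      finally show ?thesis by (simp add: a_def)
    qed
    have "a \<le> f (X i \<omega>)" if "h (2 ^ n) < real (g (X i \<omega>))" for i \<omega>
    proof -
      have "h (2 ^ n) ^ k \<le> real (g (X i \<omega>)) ^ k"
        using that by (intro power_mono) (auto simp: h_def)
      then have "a \<le> c * real (g (X i \<omega>)) ^ k"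
        unfolding h_pow[symmetric] using c by simp
      also have "\<dots> \<le> f (X i \<omega>)" by (rule dom)
      finally show ?thesis .
    qed
    then have "prob (B n) \<le> prob {\<omega> \<in> space M. \<exists>i\<le>2 ^ Suc n. a \<le> f (X i \<omega>)}"
      unfolding B_def by (intro finite_measure_mono) (blast, measurable)
    also have "\<dots> \<le> (f s\<^sub>0 + real (2 ^ Suc n) * C) / a"
      by (rule maximal_inequality[OF f C drift a_pos])
    also have "\<dots> \<le> (2 ^ n * (f s\<^sub>0 + 2 * C)) / a"
    proof (rule divide_right_mono)
      have "1 * f s\<^sub>0 \<le> 2 ^ n * f s\<^sub>0" by (intro mult_right_mono f) simp
      then show "f s\<^sub>0 + real (2 ^ Suc n) * C \<le> 2 ^ n * (f s\<^sub>0 + 2 * C)"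
        by (simp add: algebra_simps)
    qed (use a_pos in simp)
    also have "\<dots> = (f s\<^sub>0 + 2 * C) / (c * (real n * ln 2) powr q)"
      unfolding a_def mult.left_commute[of c "2 ^ n"] by (rule mult_divide_mult_cancel_left) simp
    also have "\<dots> = c' * real n powr (- q)"
      using n by (simp add: c'_def powr_mult powr_minus field_simps)
    finally show ?thesis .
  qed
  have "summable (\<lambda>n. c' * real n powr (- q))"
    using q by (intro summable_mult) (simp add: summable_real_powr_iff)
  then have "summable (\<lambda>n. prob (B n))"
    by (rule summable_comparison_test'[where N = 1]) (use prob_B in simp)
  then have "AE \<omega> in M. eventually (\<lambda>n. \<omega> \<in> space M - B n) sequentially"
    by (intro borel_cantelli_AE1) (auto simp: emeasure_eq_measure)
  with AE_space show ?thesis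
  proof eventually_elim
    case (elim \<omega>)
    then have \<omega>: "\<omega> \<in> space M" by simp
    from elim obtain n\<^sub>0 where n\<^sub>0: "\<And>n. n\<^sub>0 \<le> n \<Longrightarrow> \<omega> \<notin> B n"
      by (auto simp: eventually_sequentially)
    have "real (MAX s\<in>{0..t}. g (X s \<omega>)) \<le> h (real t)" if t: "2 ^ n\<^sub>0 \<le> t" for t
    proof -
      have "1 \<le> t" using t order_trans[OF one_le_power[of "2::nat" n\<^sub>0] t] by simp
      then obtain n where n: "2 ^ n \<le> t" "t < 2 ^ (n + 1)"
        using ex_power_ivl1[of 2 t] by auto
      have "(2::nat) ^ n\<^sub>0 < 2 ^ (n + 1)" using t n(2) by (rule order.strict_trans1)
      then have "n\<^sub>0 < n + 1" by (subst (asm) power_strict_increasing_iff) auto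
      then have "\<omega> \<notin> B n" by (intro n\<^sub>0) simp
      then have g: "real (g (X i \<omega>)) \<le> h (2 ^ n)" if "i \<le> t" for i
        using that n \<omega> unfolding B_def by (auto simp: not_less dest: spec[of _ i])
      have "(MAX s\<in>{0..t}. g (X s \<omega>)) \<in> (\<lambda>s. g (X s \<omega>)) ` {0..t}"
        by (intro Max_in) auto
      then obtain s where "(MAX s\<in>{0..t}. g (X s \<omega>)) = g (X s \<omega>)" "s \<in> {0..t}"
        by (rule imageE)
      then have "real (MAX s\<in>{0..t}. g (X s \<omega>)) \<le> h (2 ^ n)" using g by simp
      also have "h (2 ^ n) \<le> h (real t)"
      proof (rule h_mono)
        have "real (2 ^ n) \<le> real t" using n(1) by (subst of_nat_le_iff)
        then show "2 ^ n \<le> real t" by simp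
      qed simp
      finally show ?thesis .
    qed
    then show "\<forall>\<^sub>\<infinity>t. real (MAX s\<in>{0..t}. g (X s \<omega>)) \<le>
        real t powr (1 / real k) * ln (real t) powr (1 / real k + \<epsilon>)"
      unfolding cofinite_eq_sequentially eventually_sequentially h_def by blast
  qed
qed

end

section \<open>Weighted inversions\<close>

definition inversions :: "labelling \<Rightarrow> (int \<times> int) set" where
  "inversions S = {(i, j). i < j \<and> \<not> S i \<and> S j}"

definition potential :: "(int \<Rightarrow> real) \<Rightarrow> labelling \<Rightarrow> real" where
  "potential w S = (\<Sum>(i, j)\<in>inversions S. w (j - i))"

definition zeros_before :: "labelling \<Rightarrow> int \<Rightarrow> int set" where
  "zeros_before S x = {i. i < x \<and> \<not> S i}"

definition ones_after :: "labelling \<Rightarrow> int \<Rightarrow> int set" where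
  "ones_after S x = {j. x < j \<and> S j}"

text \<open>The increase of the potential when the label at \<open>x\<close> is raised from \<open>0\<close> to \<open>1\<close>.\<close>

definition flip_gain :: "(int \<Rightarrow> real) \<Rightarrow> labelling \<Rightarrow> int \<Rightarrow> real" where
  "flip_gain w S x = (\<Sum>i\<in>zeros_before S x. w (x - i)) - (\<Sum>j\<in>ones_after S x. w (j - x))"

text \<open>The increase of the potential, apart from the interaction of \<open>x\<close> with \<open>x + 1\<close>, when a \<open>1\<close>
  moves from \<open>x\<close> to \<open>x + 1\<close>: the zeros on the left are then one unit further from that \<open>1\<close>, and
  the ones on the right one unit further from the \<open>0\<close> for which it is exchanged.\<close>

definition shift_gain :: "(int \<Rightarrow> real) \<Rightarrow> labelling \<Rightarrow> int \<Rightarrow> real" where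
  "shift_gain w S x = (\<Sum>i\<in>zeros_before S x. w (x + 1 - i) - w (x - i)) +
     (\<Sum>j\<in>ones_after S (x + 1). w (j - x) - w (j - (x + 1)))"

lemma finite_zeros_before:
  assumes "admissible S" shows "finite (zeros_before S x)"
proof -
  obtain a b where "\<And>x. x < a \<Longrightarrow> S x" using admissible_bounds[OF assms] by metis
  then have "zeros_before S x \<subseteq> {a..x}" by (force simp: zeros_before_def)
  then show ?thesis by (rule finite_subset) simp
qed

lemma finite_ones_after:
  assumes "admissible S" shows "finite (ones_after S x)"
proof -
  obtain a b where "\<And>x. b < x \<Longrightarrow> \<not> S x" using admissible_bounds[OF assms] by metis
  then have "ones_after S x \<subseteq> {x..b}" by (force simp: ones_after_def)
  then show ?thesis by (rule finite_subset) simp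
qed

lemma finite_inversions:
  assumes "admissible S" shows "finite (inversions S)"
proof -
  obtain a b where ab: "\<And>x. x < a \<Longrightarrow> S x" "\<And>x. b < x \<Longrightarrow> \<not> S x"
    using admissible_bounds[OF assms] by metis
  have "inversions S \<subseteq> {a..b} \<times> {a..b}"
  proof
    fix z assume "z \<in> inversions S"
    then obtain i j where "z = (i, j)" "i < j" "\<not> S i" "S j" by (auto simp: inversions_def)
    then show "z \<in> {a..b} \<times> {a..b}" using ab(1)[of i] ab(2)[of j] by force
  qed
  then show ?thesis by (rule finite_subset) simp
qed

text \<open>Only inversions that involve \<open>x\<close> change: with a \<open>1\<close> at \<open>x\<close> they are formed with the zeros on
  its left, with a \<open>0\<close> at \<open>x\<close> with the ones on its right.\<close>

lemma potential_flip:
  assumes S: "admissible S"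
  shows "potential w (S(x := True)) = potential w (S(x := False)) + flip_gain w S x"
proof -
  define C where "C = {(i, j) \<in> inversions S. i \<noteq> x \<and> j \<noteq> x}"
  have C: "finite C"
    unfolding C_def by (rule finite_subset[OF _ finite_inversions[OF S]]) auto
  have "inversions (S(x := True)) = C \<union> (\<lambda>i. (i, x)) ` zeros_before S x"
    by (auto simp: inversions_def C_def zeros_before_def split: if_splits)
  moreover have "C \<inter> (\<lambda>i. (i, x)) ` zeros_before S x = {}"
    by (auto simp: C_def)
  ultimately have T: "potential w (S(x := True)) =
      (\<Sum>(i, j)\<in>C. w (j - i)) + (\<Sum>i\<in>zeros_before S x. w (x - i))"
    unfolding potential_def
    by (simp add: sum.union_disjoint C finite_zeros_before[OF S] sum.reindex inj_on_def)
  have "inversions (S(x := False)) = C \<union> (\<lambda>j. (x, j)) ` ones_after S x"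
    by (auto simp: inversions_def C_def ones_after_def split: if_splits)
  moreover have "C \<inter> (\<lambda>j. (x, j)) ` ones_after S x = {}"
    by (auto simp: C_def)
  ultimately have F: "potential w (S(x := False)) =
      (\<Sum>(i, j)\<in>C. w (j - i)) + (\<Sum>j\<in>ones_after S x. w (j - x))"
    unfolding potential_def
    by (simp add: sum.union_disjoint C finite_ones_after[OF S] sum.reindex inj_on_def)
  show ?thesis unfolding T F flip_gain_def by simp
qed

lemma flip_gain_right:
  assumes S: "admissible S"
  shows "flip_gain w (S(x := b)) (x + 1) =
    flip_gain w S x + shift_gain w S x + (if b then 0 else w 1) + (if S (x + 1) then w 1 else 0)"
proof -
  have "zeros_before (S(x := b)) (x + 1) = (if b then {} else {x}) \<union> zeros_before S x"
    by (auto simp: zeros_before_def)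
  moreover have "x \<notin> zeros_before S x" by (simp add: zeros_before_def)
  ultimately have Z: "(\<Sum>i\<in>zeros_before (S(x := b)) (x + 1). w (x + 1 - i)) =
      (if b then 0 else w 1) + (\<Sum>i\<in>zeros_before S x. w (x + 1 - i))"
    using finite_zeros_before[OF S] by auto
  have O1: "ones_after (S(x := b)) (x + 1) = ones_after S (x + 1)"
    by (auto simp: ones_after_def)
  have "ones_after S x = (if S (x + 1) then {x + 1} else {}) \<union> ones_after S (x + 1)"
  proof (rule set_eqI)
    fix j show "j \<in> ones_after S x \<longleftrightarrow>
        j \<in> (if S (x + 1) then {x + 1} else {}) \<union> ones_after S (x + 1)"
      by (cases "j = x + 1") (auto simp: ones_after_def)
  qed
  moreover have "x + 1 \<notin> ones_after S (x + 1)" by (simp add: ones_after_def)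
  ultimately have O2: "(\<Sum>j\<in>ones_after S x. w (j - x)) =
      (if S (x + 1) then w 1 else 0) + (\<Sum>j\<in>ones_after S (x + 1). w (j - x))"
    using finite_ones_after[OF S] by auto
  show ?thesis
    unfolding flip_gain_def shift_gain_def O1 O2 Z sum_subtractf by simp
qed

lemma potential_nonneg:
  assumes "\<And>d. 0 < d \<Longrightarrow> 0 \<le> w d" shows "0 \<le> potential w S"
  unfolding potential_def inversions_def using assms by (intro sum_nonneg) auto

section \<open>Mean change in one step\<close>

text \<open>The mean change of the potential when the unlike pair at \<open>x\<close> has been chosen. For a pair \<open>10\<close>
  the two voter moves change it by \<open>flip_gain w S (x + 1)\<close> and by \<open>- flip_gain w S x\<close>; for a pair
  \<open>01\<close> the signs are reversed. In either case the average is half the difference of the two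
  gains up to sign, and \<open>flip_gain_right\<close> expresses it through \<open>shift_gain\<close>.\<close>

definition pair_drift :: "real \<Rightarrow> real \<Rightarrow> (int \<Rightarrow> real) \<Rightarrow> labelling \<Rightarrow> int \<Rightarrow> real" where
  "pair_drift \<beta> p w S x = (if S x
     then \<beta> * (shift_gain w S x / 2) + (1 - \<beta>) * ((1 - p) * (shift_gain w S x + w 1))
     else - \<beta> * (shift_gain w S x / 2 + w 1) - (1 - \<beta>) * (p * (shift_gain w S x + w 1)))"

lemma set_pmf_moves_finite:
  "finite (set_pmf (voter_move S x))" "finite (set_pmf (exclusion_move p S x))"
  unfolding voter_move_def exclusion_move_def by auto

lemma expectation_move:
  assumes S: "admissible S" and x: "S x \<noteq> S (x + 1)" and p: "p \<in> {0..1}"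
  shows "\<beta> * measure_pmf.expectation (voter_move S x) (potential w)
      + (1 - \<beta>) * measure_pmf.expectation (exclusion_move p S x) (potential w)
    = potential w S + pair_drift \<beta> p w S x"
proof (cases "S x")
  case True
  with x have F: "\<not> S (x + 1)" by simp
  have 1: "S(x := True) = S" and 2: "S(x := False, x + 1 := False) = S(x := False)"
    and 3: "S(x := True, x + 1 := True) = S(x + 1 := True)"
    and 4: "S(x + 1 := False) = S"
    using True F by (auto simp: fun_eq_iff)
  have a: "potential w (S(x := False)) = potential w S - flip_gain w S x"
    using potential_flip[OF S, of w x] by (simp add: 1)
  have b: "potential w (S(x + 1 := True)) = potential w S + flip_gain w S x + shift_gain w S x"
    using potential_flip[OF S, of w "x + 1"] flip_gain_right[OF S, of w x True] F
    by (simp only: 4 1) simp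
  have c: "potential w (S(x := False, x + 1 := True)) =
      potential w S + shift_gain w S x + w 1"
    using potential_flip[OF admissible_upd[OF S], of w x False "x + 1"]
      flip_gain_right[OF S, of w x False] F a by (simp only: 2) simp
  have "measure_pmf.expectation (voter_move S x) (potential w) = potential w S + shift_gain w S x / 2"
    unfolding voter_move_def using 2 3 a b by (simp add: field_simps)
  moreover have "measure_pmf.expectation (exclusion_move p S x) (potential w) =
      potential w S + (1 - p) * (shift_gain w S x + w 1)"
    unfolding exclusion_move_def using True p by (simp add: c) (simp add: algebra_simps)
  ultimately show ?thesis
    using True by (simp only: pair_drift_def if_True if_False) (simp add: algebra_simps)
next
  case False
  with x have T: "S (x + 1)" by simp
  have 1: "S(x := False) = S" and 2: "S(x := True, x + 1 := True) = S(x := True)"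
    and 3: "S(x := False, x + 1 := False) = S(x + 1 := False)"
    and 4: "S(x + 1 := True) = S"
    using False T by (auto simp: fun_eq_iff)
  have a: "potential w (S(x := True)) = potential w S + flip_gain w S x"
    using potential_flip[OF S, of w x] by (simp add: 1)
  have b: "potential w (S(x + 1 := False)) =
      potential w S - flip_gain w S x - shift_gain w S x - 2 * w 1"
    using potential_flip[OF S, of w "x + 1"] flip_gain_right[OF S, of w x False] T
    by (simp only: 4 1) simp
  have c: "potential w (S(x := True, x + 1 := False)) = potential w S - shift_gain w S x - w 1"
    using potential_flip[OF admissible_upd[OF S], of w x True "x + 1"]
      flip_gain_right[OF S, of w x True] T a by (simp only: 2) simp
  have "measure_pmf.expectation (voter_move S x) (potential w) =
      potential w S - shift_gain w S x / 2 - w 1"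
    unfolding voter_move_def using 2 3 a b by (simp add: field_simps)
  moreover have "measure_pmf.expectation (exclusion_move p S x) (potential w) =
      potential w S - p * (shift_gain w S x + w 1)"
    unfolding exclusion_move_def using False p by (simp add: c) (simp add: algebra_simps)
  ultimately show ?thesis
    using False by (simp only: pair_drift_def if_True if_False) (simp add: algebra_simps)
qed

lemma finite_set_labelling_step:
  assumes S: "admissible S" shows "finite (set_pmf (labelling_step \<beta> p S))"
  unfolding labelling_step_def using finite_unlike_pairs[OF S] unlike_pairs_nonempty[OF S]
  by (auto simp: set_pmf_moves_finite)

lemma expectation_labelling_step:
  assumes S: "admissible S" and \<beta>: "\<beta> \<in> {0..1}" and p: "p \<in> {0..1}"
  shows "measure_pmf.expectation (labelling_step \<beta> p S) (potential w) =
    potential w S + (\<Sum>x\<in>unlike_pairs S. pair_drift \<beta> p w S x) / card (unlike_pairs S)"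
proof -
  let ?U = "unlike_pairs S" and ?E = measure_pmf.expectation
  note U = finite_unlike_pairs[OF S] unlike_pairs_nonempty[OF S]
  have bind: "?E (bind_pmf (pmf_of_set ?U) m) (potential w) =
      (\<Sum>x\<in>?U. ?E (m x) (potential w)) / card ?U"
    if "\<And>x. finite (set_pmf (m x))" for m :: "int \<Rightarrow> labelling pmf"
    using U that by (subst pmf_expectation_bind[of ?U]) (auto simp: sum_divide_distrib)
  have "?E (labelling_step \<beta> p S) (potential w) =
      \<beta> * ?E (bind_pmf (pmf_of_set ?U) (voter_move S)) (potential w) +
      (1 - \<beta>) * ?E (bind_pmf (pmf_of_set ?U) (exclusion_move p S)) (potential w)"
    unfolding labelling_step_def using U \<beta>
    by (subst pmf_expectation_bind[of UNIV])
       (auto simp: UNIV_bool set_pmf_moves_finite)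
  also have "\<dots> = (\<Sum>x\<in>?U. \<beta> * ?E (voter_move S x) (potential w) +
      (1 - \<beta>) * ?E (exclusion_move p S x) (potential w)) / card ?U"
    by (simp add: bind set_pmf_moves_finite sum.distrib sum_distrib_left add_divide_distrib)
  also have "\<dots> = (\<Sum>x\<in>?U. potential w S + pair_drift \<beta> p w S x) / card ?U"
    using expectation_move[OF S _ p] by (simp add: unlike_pairs_def)
  also have "\<dots> = potential w S + (\<Sum>x\<in>?U. pair_drift \<beta> p w S x) / card ?U"
    using U by (simp add: sum.distrib field_simps)
  finally show ?thesis .
qed

section \<open>Bounded drift of the number and of the total length of inversions\<close>

abbreviation inversion_count :: "labelling \<Rightarrow> real" where
  "inversion_count \<equiv> potential (\<lambda>d. 1)"

abbreviation inversion_length :: "labelling \<Rightarrow> real" where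
  "inversion_length \<equiv> potential real_of_int"

text \<open>With constant weight \<open>shift_gain\<close> vanishes: a voter move leaves the mean number of inversions
  unchanged at a pair \<open>10\<close> and lowers it at a pair \<open>01\<close>, and an exclusion move creates at
  most one.\<close>

lemma inversion_count_drift:
  assumes S: "admissible S" and \<beta>: "\<beta> \<in> {0..1}" and p: "p \<in> {0..1}"
  shows "measure_pmf.expectation (labelling_step \<beta> p S) inversion_count \<le> inversion_count S + 1"
proof -
  let ?U = "unlike_pairs S"
  have "pair_drift \<beta> p (\<lambda>d. 1) S x \<le> 1" for x
  proof -
    have "(1 - \<beta>) * (1 - p) \<le> 1" using \<beta> p by (intro mult_le_one) auto
    moreover have "0 \<le> (1 - \<beta>) * p" using \<beta> p by auto
    ultimately show ?thesis using \<beta> by (auto simp: pair_drift_def shift_gain_def)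
  qed
  then have "(\<Sum>x\<in>?U. pair_drift \<beta> p (\<lambda>d. 1) S x) \<le> real (card ?U) * 1"
    by (intro sum_bounded_above)
  then have "(\<Sum>x\<in>?U. pair_drift \<beta> p (\<lambda>d. 1) S x) / card ?U \<le> 1"
    by (simp add: divide_le_eq)
  then show ?thesis by (simp add: expectation_labelling_step[OF S \<beta> p])
qed

lemma shift_gain_length:
  "shift_gain real_of_int S x = real (card (zeros_before S x) + card (ones_after S (x + 1)))"
  by (simp add: shift_gain_def flip: of_int_diff)

lemma card_zeros_before_Suc:
  assumes "admissible S"
  shows "card (zeros_before S (x + 1)) = card (zeros_before S x) + of_bool (\<not> S x)"
proof -
  have "zeros_before S (x + 1) = zeros_before S x \<union> (if S x then {} else {x})"
  proof (rule set_eqI)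
    fix i show "i \<in> zeros_before S (x + 1) \<longleftrightarrow> i \<in> zeros_before S x \<union> (if S x then {} else {x})"
      by (cases "i = x") (auto simp: zeros_before_def)
  qed
  then show ?thesis
    using finite_zeros_before[OF assms, of x] by (auto simp: zeros_before_def)
qed

lemma card_ones_after_Suc:
  assumes "admissible S"
  shows "card (ones_after S x) = card (ones_after S (x + 1)) + of_bool (S (x + 1))"
proof -
  have "ones_after S x = ones_after S (x + 1) \<union> (if S (x + 1) then {x + 1} else {})"
  proof (rule set_eqI)
    fix j show "j \<in> ones_after S x \<longleftrightarrow> j \<in> ones_after S (x + 1) \<union> (if S (x + 1) then {x + 1} else {})"
      by (cases "j = x + 1") (auto simp: ones_after_def)
  qed
  then show ?thesis
    using finite_ones_after[OF assms, of "x + 1"] by (auto simp: ones_after_def)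
qed

text \<open>Summation by parts. Let \<open>h x\<close> be the number of zeros at or to the left of \<open>x\<close> plus the number of
  ones to the right of \<open>x\<close>. Each summand is \<open>(s x - s (x + 1)) * h x\<close> for the \<open>0\<close>-\<open>1\<close> indicator
  \<open>s\<close> of \<open>S\<close>, and \<open>h (x + 1) - h x = 1 - 2 * s (x + 1)\<close>; hence the partial sums telescope, and
  they vanish far to the right, where there are no ones left. The identity says that
  a voter move at a uniformly chosen unlike pair leaves the mean of \<open>inversion_length\<close> unchanged.\<close>

lemma unlike_pairs_balance:
  assumes S: "admissible S"
  shows "(\<Sum>x\<in>unlike_pairs S. if S x then shift_gain real_of_int S x
            else - (shift_gain real_of_int S x + 2)) = 0"
proof -
  define h where "h x = real (card (zeros_before S (x + 1)) + card (ones_after S x))" for x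
  define s where "s x = (of_bool (S x) :: real)" for x
  obtain a b where ab: "a \<le> b" "\<And>x. x < a \<Longrightarrow> S x" "\<And>x. b < x \<Longrightarrow> \<not> S x"
    using admissible_bounds[OF S] by metis
  define A B where "A = a - 1" and "B = b + 1"
  have partial: "(\<Sum>x\<in>{A..<n}. (s x - s (x + 1)) * h x) = real (card (ones_after S n)) - s n * h n"
    if "A \<le> n" for n
    using that
  proof (induction n rule: int_ge_induct)
    case base
    have "zeros_before S (A + 1) = {}" using ab(2) by (auto simp: zeros_before_def A_def)
    moreover have "S A" using ab(2) by (simp add: A_def)
    ultimately show ?case by (simp add: h_def s_def)
  next
    case (step n)
    have "{A..<n + 1} = insert n {A..<n}" using step.hyps by auto
    then have "(\<Sum>x\<in>{A..<n + 1}. (s x - s (x + 1)) * h x) =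
        real (card (ones_after S n)) - s n * h n + (s n - s (n + 1)) * h n"
      using step.IH by simp
    also have "\<dots> = real (card (ones_after S (n + 1))) - s (n + 1) * h (n + 1)"
      using card_zeros_before_Suc[OF S, of "n + 1"] card_ones_after_Suc[OF S, of n]
      by (cases "S (n + 1)") (simp_all add: h_def s_def algebra_simps)
    finally show ?case .
  qed
  have "(\<Sum>x\<in>unlike_pairs S. if S x then shift_gain real_of_int S x
            else - (shift_gain real_of_int S x + 2)) = (\<Sum>x\<in>unlike_pairs S. (s x - s (x + 1)) * h x)"
  proof (rule sum.cong)
    fix x assume "x \<in> unlike_pairs S"
    then show "(if S x then shift_gain real_of_int S x else - (shift_gain real_of_int S x + 2)) =
        (s x - s (x + 1)) * h x"
      using card_zeros_before_Suc[OF S, of x] card_ones_after_Suc[OF S, of x]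
      by (auto simp: unlike_pairs_def s_def h_def shift_gain_length)
  qed simp
  also have "\<dots> = (\<Sum>x\<in>{A..<B}. (s x - s (x + 1)) * h x)"
  proof (rule sum.mono_neutral_left)
    show "unlike_pairs S \<subseteq> {A..<B}"
    proof
      fix x assume x: "x \<in> unlike_pairs S"
      have "A \<le> x" using ab(2)[of x] ab(2)[of "x + 1"] x
        by (cases "A \<le> x") (auto simp: unlike_pairs_def A_def)
      moreover have "x < B" using ab(3)[of x] ab(3)[of "x + 1"] x
        by (cases "x < B") (auto simp: unlike_pairs_def B_def)
      ultimately show "x \<in> {A..<B}" by simp
    qed
  qed (auto simp: unlike_pairs_def s_def)
  also have "\<dots> = 0"
  proof -
    have "ones_after S B = {}" "\<not> S B" using ab(3) by (auto simp: ones_after_def B_def)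
    moreover have "A \<le> B" using ab(1) by (simp add: A_def B_def)
    ultimately show ?thesis using partial[of B] by (simp add: s_def)
  qed
  finally show ?thesis .
qed

text \<open>Exchanging the labels of a pair at \<open>x\<close> changes \<open>inversion_length\<close> by \<open>e x + 1\<close> for a
  pair \<open>10\<close> and by \<open>- (e x + 1)\<close> for a pair \<open>01\<close>, where \<open>e = shift_gain real_of_int S \<ge> 0\<close>. These large
  changes occur with probabilities \<open>1 - p \<le> 1/2\<close> and \<open>p \<ge> 1/2\<close>, and by
  \<open>unlike_pairs_balance\<close> they cancel at \<open>p = 1/2\<close> up to \<open>1/2\<close> per unlike pair.\<close>

lemma inversion_length_drift:
  assumes S: "admissible S" and \<beta>: "\<beta> \<in> {0..1}" and p: "p \<in> {1/2..1}"
  shows "measure_pmf.expectation (labelling_step \<beta> p S) inversion_length \<le> inversion_length S + 1"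
proof -
  let ?U = "unlike_pairs S" and ?e = "shift_gain real_of_int S"
  let ?bal = "\<lambda>x. if S x then ?e x else - (?e x + 2)"
  have "pair_drift \<beta> p real_of_int S x \<le> ?bal x / 2 + 1 / 2" for x
  proof -
    define e where "e = ?e x"
    let ?h = "(e + 1) / 2"
    have e: "0 \<le> e" by (simp add: e_def shift_gain_length)
    have "(1 - p) * (e + 1) \<le> 1 / 2 * (e + 1)" "1 / 2 * (e + 1) \<le> p * (e + 1)"
      using p e by (intro mult_right_mono; simp)+
    \<comment> \<open>Both kinds of move obey the same bound, so their \<open>\<beta>\<close>-mixture does.\<close>
    then have "\<beta> * (e / 2) + (1 - \<beta>) * ((1 - p) * (e + 1)) \<le> ?h"
      and "\<beta> * (- (e / 2 + 1)) + (1 - \<beta>) * (- (p * (e + 1))) \<le> - ?h"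
      using \<beta> by (intro convex_bound_le; simp add: field_simps)+
    then show ?thesis by (cases "S x") (simp_all add: pair_drift_def e_def field_simps)
  qed
  then have "(\<Sum>x\<in>?U. pair_drift \<beta> p real_of_int S x) \<le> (\<Sum>x\<in>?U. ?bal x / 2 + 1 / 2)"
    by (rule sum_mono)
  also have "\<dots> = (\<Sum>x\<in>?U. ?bal x) / 2 + card ?U / 2"
    by (simp add: sum.distrib sum_divide_distrib)
  also have "\<dots> = card ?U / 2"
    by (simp add: unlike_pairs_balance[OF S])
  finally have "(\<Sum>x\<in>?U. pair_drift \<beta> p real_of_int S x) / card ?U \<le> 1"
    by (simp add: divide_le_eq)
  then show ?thesis using p by (subst expectation_labelling_step[OF S \<beta>]) auto
qed

section \<open>Blocks are disjoint\<close>

text \<open>Overlapping strings have a string as their union, so by maximality a block contains every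
  string that it meets. Distinct blocks are therefore disjoint, and a block that reaches
  into one of the two constant tails is infinite.\<close>

lemma strings_Un:
  assumes "B \<in> strings v S" "C \<in> strings v S" "B \<inter> C \<noteq> {}"
  shows "B \<union> C \<in> strings v S"
proof -
  obtain z where z: "z \<in> B" "z \<in> C" using assms(3) by blast
  have iv: "{x..y} \<subseteq> B" if "x \<in> B" "y \<in> B" for x y
    using assms(1) that by (auto simp: strings_def)
  have iv': "{x..y} \<subseteq> C" if "x \<in> C" "y \<in> C" for x y
    using assms(2) that by (auto simp: strings_def)
  have "{x..y} \<subseteq> B \<union> C" if "x \<in> B \<union> C" "y \<in> B \<union> C" for x y
  proof -
    have "{x..y} \<subseteq> {x..z} \<union> {z..y}" by auto
    then show ?thesis
      using that z iv[of x y] iv[of x z] iv[of z y] iv'[of x y] iv'[of x z] iv'[of z y] by blast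
  qed
  then show ?thesis using assms by (auto simp: strings_def)
qed

lemma block_absorbs:
  assumes B: "B \<in> blocks v S" and C: "C \<in> strings v S" and "B \<inter> C \<noteq> {}"
  shows "C \<subseteq> B"
proof -
  have "B \<union> C \<in> strings v S" using assms by (intro strings_Un) (auto simp: blocks_def)
  then have "B \<union> C = B" using B by (auto simp: blocks_def)
  then show ?thesis by blast
qed

lemma blocks_disjoint:
  assumes "B \<in> blocks v S" "C \<in> blocks v S" "B \<inter> C \<noteq> {}" shows "B = C"
  using block_absorbs[of B v S C] block_absorbs[of C v S B] assms by (auto simp: blocks_def)

definition rises :: "labelling \<Rightarrow> int set" where
  "rises S = {x. \<not> S x \<and> S (x + 1)}"

lemma finite_rises: "admissible S \<Longrightarrow> finite (rises S)"
  by (rule finite_subset[OF _ finite_unlike_pairs]) (auto simp: rises_def unlike_pairs_def)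

text \<open>Each finite \<open>1\<close>-block is preceded by a \<open>0\<close>, and the site of this \<open>0\<close> determines the block.\<close>

lemma card_finite_blocks_le:
  assumes S: "admissible S"
  shows "card (finite_blocks True S) \<le> card (rises S)"
proof (rule card_inj_on_le)
  have fin: "finite B" "B \<noteq> {}" "B \<in> blocks True S" "\<And>x. x \<in> B \<Longrightarrow> S x"
    if "B \<in> finite_blocks True S" for B
    using that by (auto simp: finite_blocks_def blocks_def strings_def)
  show "inj_on (\<lambda>B. Min B - 1) (finite_blocks True S)"
  proof (rule inj_onI)
    fix B C assume B: "B \<in> finite_blocks True S" and C: "C \<in> finite_blocks True S"
      and "Min B - 1 = Min C - 1"
    then have "Min B \<in> B \<inter> C" using fin(1,2) by (metis IntI Min_in diff_add_cancel)
    then show "B = C" using fin(3)[OF B] fin(3)[OF C] blocks_disjoint by blast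
  qed
  show "(\<lambda>B. Min B - 1) ` finite_blocks True S \<subseteq> rises S"
  proof (rule image_subsetI)
    fix B assume B: "B \<in> finite_blocks True S"
    let ?m = "Min B"
    have m: "?m \<in> B" using fin(1,2)[OF B] by simp
    have "\<not> S (?m - 1)"
    proof
      assume "S (?m - 1)"
      then have "{?m - 1..?m} \<in> strings True S"
      proof -
        have "{?m - 1..?m} = {?m - 1, ?m}" by auto
        then show ?thesis using \<open>S (?m - 1)\<close> fin(4)[OF B m] by (simp add: strings_def)
      qed
      then have "{?m - 1..?m} \<subseteq> B"
        using m by (intro block_absorbs[OF fin(3)[OF B]]) auto
      then have "?m \<le> ?m - 1" using fin(1)[OF B] by (intro Min_le) auto
      then show False by simp
    qed
    then show "?m - 1 \<in> rises S" using fin(4)[OF B m] by (simp add: rises_def)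
  qed
  show "finite (rises S)" by (rule finite_rises[OF S])
qed

section \<open>Lower bounds for the potentials\<close>

text \<open>The distances are distinct positive integers, so their sum is at least \<open>1 + 2 + \<dots> + card A\<close>.\<close>

lemma sum_distances_ge:
  fixes A :: "int set"
  assumes "finite A" "\<And>x. x \<in> A \<Longrightarrow> x \<le> M"
  shows "real (card A) * (real (card A) + 1) / 2 \<le> (\<Sum>x\<in>A. real_of_int (M + 1 - x))"
  using assms
proof (induction A arbitrary: M rule: finite_linorder_max_induct)
  case (insert b A)
  have b: "b \<notin> A" "b \<le> M" using insert by auto
  have "(\<Sum>x\<in>A. real_of_int (b - 1 + 1 - x)) + real (card A) \<le> (\<Sum>x\<in>A. real_of_int (M + 1 - x))"
  proof -
    have "(\<Sum>x\<in>A. real_of_int (b - 1 + 1 - x) + 1) \<le> (\<Sum>x\<in>A. real_of_int (M + 1 - x))"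
      using b(2) by (intro sum_mono) simp
    then show ?thesis by (simp add: sum.distrib)
  qed
  moreover have "real (card A) * (real (card A) + 1) / 2 \<le> (\<Sum>x\<in>A. real_of_int (b - 1 + 1 - x))"
    using insert.hyps by (intro insert.IH) force
  moreover have "1 \<le> real_of_int (M + 1 - b)" using b(2) by simp
  ultimately show ?case
    using b insert.hyps by (simp add: field_simps)
qed simp

lemma sum_le_potential:
  assumes S: "admissible S" and w: "\<And>d. 0 < d \<Longrightarrow> 0 \<le> w d"
    and A: "A \<subseteq> inversions S"
  shows "(\<Sum>(i, j)\<in>A. w (j - i)) \<le> potential w S"
  unfolding potential_def using A w
  by (intro sum_mono2 finite_inversions[OF S]) (auto simp: inversions_def)

text \<open>For rises \<open>x \<le> y\<close> the pair \<open>(x, y + 1)\<close> is an inversion. Group these inversions by \<open>y\<close>: the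
  \<open>k\<close>th rise from the left contributes \<open>k\<close> of them, and \<open>\<phi> k\<close> bounds their
  joint weight.\<close>

lemma potential_ge_sum_rises:
  assumes S: "admissible S" and w: "\<And>d. 0 < d \<Longrightarrow> 0 \<le> w d"
    and \<phi>: "\<And>M A. finite A \<Longrightarrow> (\<And>x. x \<in> A \<Longrightarrow> x \<le> M) \<Longrightarrow> \<phi> (card A) \<le> (\<Sum>x\<in>A. w (M + 1 - x))"
  shows "(\<Sum>k=1..card (rises S). \<phi> k) \<le> potential w S"
proof -
  \<comment> \<open>Induct by adding a new largest rise, which is the larger rise in all new pairs.\<close>
  have ordered_pairs: "(\<Sum>k=1..card R. \<phi> k) \<le> (\<Sum>y\<in>R. \<Sum>x\<in>{x \<in> R. x \<le> y}. w (y + 1 - x))"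
    if "finite R" for R :: "int set"
    using that
  proof (induction R rule: finite_linorder_max_induct)
    case (insert b R)
    have b: "b \<notin> R" using insert.hyps by auto
    have "{x \<in> insert b R. x \<le> b} = insert b R" using insert.hyps by auto
    moreover have "{x \<in> insert b R. x \<le> y} = {x \<in> R. x \<le> y}" if "y \<in> R" for y
      using insert.hyps that by auto
    moreover have "\<phi> (card (insert b R)) \<le> (\<Sum>x\<in>insert b R. w (b + 1 - x))"
      using insert.hyps by (intro \<phi>) auto
    ultimately show ?case using insert.IH insert.hyps b by simp
  qed simp
  let ?P = "Sigma (rises S) (\<lambda>y. {x \<in> rises S. x \<le> y})"
  have "(\<Sum>y\<in>rises S. \<Sum>x\<in>{x \<in> rises S. x \<le> y}. w (y + 1 - x)) =
      (\<Sum>(y, x)\<in>?P. w (y + 1 - x))"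
    using finite_rises[OF S] by (subst sum.Sigma) auto
  also have "\<dots> = (\<Sum>(i, j)\<in>(\<lambda>(y, x). (x, y + 1)) ` ?P. w (j - i))"
    by (subst sum.reindex) (auto simp: inj_on_def case_prod_unfold)
  also have "\<dots> \<le> potential w S"
    by (rule sum_le_potential[OF S w]) (auto simp: inversions_def rises_def)
  finally show ?thesis using ordered_pairs[OF finite_rises[OF S]] by linarith
qed

lemma inversion_count_ge:
  assumes S: "admissible S"
  shows "1 / 2 * real (card (finite_blocks True S)) ^ 2 \<le> inversion_count S"
proof -
  let ?n = "card (rises S)"
  have gauss: "(\<Sum>k=1..n. real k) = real n * (real n + 1) / 2" for n
    by (induction n) (auto simp: field_simps)
  have "real (card (finite_blocks True S)) ^ 2 \<le> real ?n ^ 2"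
    using card_finite_blocks_le[OF S] by (intro power_mono) auto
  also have "\<dots> \<le> 2 * (\<Sum>k=1..?n. real k)"
    unfolding gauss by (simp add: power2_eq_square algebra_simps)
  also have "(\<Sum>k=1..?n. real k) \<le> inversion_count S"
    by (rule potential_ge_sum_rises[OF S]) auto
  finally show ?thesis by simp
qed

lemma inversion_length_ge_cube:
  assumes S: "admissible S"
  shows "1 / 6 * real (card (finite_blocks True S)) ^ 3 \<le> inversion_length S"
proof -
  let ?n = "card (rises S)"
  have tetrahedral: "(\<Sum>k=1..n. real k * (real k + 1) / 2) = real n * (real n + 1) * (real n + 2) / 6" for n
    by (induction n) (auto simp: field_simps)
  have "real (card (finite_blocks True S)) ^ 3 \<le> real ?n ^ 3"
    using card_finite_blocks_le[OF S] by (intro power_mono) auto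
  also have "\<dots> \<le> 6 * (\<Sum>k=1..?n. real k * (real k + 1) / 2)"
    unfolding tetrahedral by (simp add: power3_eq_cube algebra_simps)
  also have "(\<Sum>k=1..?n. real k * (real k + 1) / 2) \<le> inversion_length S"
  proof (rule potential_ge_sum_rises[OF S])
    show "real (card A) * (real (card A) + 1) / 2 \<le> (\<Sum>x\<in>A. real_of_int (M + 1 - x))"
      if "finite A" "\<And>x. x \<in> A \<Longrightarrow> x \<le> M" for M and A :: "int set"
      using that by (rule sum_distances_ge)
  qed simp
  finally show ?thesis by simp
qed

text \<open>Finite blocks cannot reach into a constant tail, so they are disjoint subsets of \<open>{a..b}\<close>.\<close>

lemma sum_card_finite_blocks_le:
  assumes ab: "\<And>x. x < a \<Longrightarrow> S x" "\<And>x. b < x \<Longrightarrow> \<not> S x"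
  shows "(\<Sum>B\<in>finite_blocks v S. card B) \<le> card {x \<in> {a..b}. S x = v}"
proof -
  have sub: "B \<subseteq> {x \<in> {a..b}. S x = v}" if B: "B \<in> finite_blocks v S" for B
  proof
    fix x assume x: "x \<in> B"
    have Bb: "B \<in> blocks v S" "finite B" and Sx: "S x = v"
      using B x by (auto simp: finite_blocks_def blocks_def strings_def)
    have "a \<le> x"
    proof (rule ccontr)
      assume "\<not> a \<le> x"
      then have "v" "{..x} \<in> strings v S" using ab(1) Sx by (auto simp: strings_def)
      then have "{..x} \<subseteq> B" using x by (intro block_absorbs[OF Bb(1)]) auto
      then show False using Bb(2) infinite_Iic finite_subset by blast
    qed
    moreover have "x \<le> b"
    proof (rule ccontr)
      assume "\<not> x \<le> b"
      then have "\<not> v" "{x..} \<in> strings v S" using ab(2) Sx by (auto simp: strings_def)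
      then have "{x..} \<subseteq> B" using x by (intro block_absorbs[OF Bb(1)]) auto
      then show False using Bb(2) infinite_Ici finite_subset by blast
    qed
    ultimately show "x \<in> {x \<in> {a..b}. S x = v}" using Sx by simp
  qed
  have "(\<Sum>B\<in>finite_blocks v S. card B) = card (\<Union>(finite_blocks v S))"
  proof (rule card_Union_disjoint[symmetric])
    show "pairwise disjnt (finite_blocks v S)"
      using blocks_disjoint[of _ v S] by (auto simp: pairwise_def disjnt_def finite_blocks_def)
  qed (simp add: finite_blocks_def)
  also have "\<dots> \<le> card {x \<in> {a..b}. S x = v}"
  proof (rule card_mono)
    show "finite {x \<in> {a..b}. S x = v}" by (rule finite_subset[of _ "{a..b}"]) auto
  qed (use sub in blast)
  finally show ?thesis .
qed

lemma admissible_tight_bounds: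
  assumes S: "admissible S"
  obtains a b where "\<not> S a" "S b" "\<And>x. x < a \<Longrightarrow> S x" "\<And>x. b < x \<Longrightarrow> \<not> S x"
proof -
  obtain l r where lr: "l \<le> r" "\<And>x. x < l \<Longrightarrow> S x" "\<And>x. r < x \<Longrightarrow> \<not> S x"
    using admissible_bounds[OF S] by metis
  let ?Z = "{x \<in> {l..r + 1}. \<not> S x}" and ?O = "{x \<in> {l - 1..r}. S x}"
  have fin: "finite ?Z" "finite ?O"
    by (rule finite_subset[of _ "{l - 1..r + 1}"]; auto)+
  have Z: "finite ?Z" "r + 1 \<in> ?Z" and O: "finite ?O" "l - 1 \<in> ?O"
    using lr fin by auto
  have Min: "Min ?Z \<in> ?Z"
    by (rule Min_in[OF Z(1)]) (use Z(2) in blast)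
  have Max: "Max ?O \<in> ?O"
    by (rule Max_in[OF O(1)]) (use O(2) in blast)
  show ?thesis
  proof (rule that)
    show "\<not> S (Min ?Z)" "S (Max ?O)" using Min Max by auto
    show "S x" if x: "x < Min ?Z" for x
    proof (rule ccontr)
      assume "\<not> S x"
      moreover have "x < r + 1" using x Min by simp
      ultimately have "x \<in> ?Z" using lr(2)[of x] by force
      then show False using x Min_le[OF Z(1)] by force
    qed
    show "\<not> S x" if x: "Max ?O < x" for x
    proof
      assume "S x"
      moreover have "l - 1 < x" using x Max by simp
      ultimately have "x \<in> ?O" using lr(3)[of x] by force
      then show False using x Max_ge[OF O(1)] by force
    qed
  qed
qed

text \<open>Let \<open>a\<close> be the leftmost \<open>0\<close> and \<open>b\<close> the rightmost \<open>1\<close>. The ones between them form inversions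
  with \<open>a\<close>, the zeros form inversions with \<open>b\<close>; their lengths are distinct, so either
  family alone contributes at least half the square of its size. In the ground state \<open>b = a - 1\<close>
  and both families are empty.\<close>

lemma inversion_length_ge_square:
  assumes S: "admissible S"
  shows "1 / 8 * real ((\<Sum>B\<in>finite_blocks False S. card B) + (\<Sum>B\<in>finite_blocks True S. card B)) ^ 2
    \<le> inversion_length S"
proof -
  obtain a b where ab: "\<not> S a" "S b" "\<And>x. x < a \<Longrightarrow> S x" "\<And>x. b < x \<Longrightarrow> \<not> S x"
    using admissible_tight_bounds[OF S] by metis
  define Z U where "Z = {x \<in> {a..b}. S x = False}" and "U = {x \<in> {a..b}. S x = True}"
  have fin: "finite Z" "finite U"
    unfolding Z_def U_def by (rule finite_subset[of _ "{a..b}"]; auto)+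
  have U: "real (card U) ^ 2 \<le> 2 * inversion_length S"
  proof -
    have ne: "x \<noteq> a" if "x \<in> U" for x using that ab(1) by (auto simp: U_def)
    \<comment> \<open>Reflection turns distances to the left end into distances to the right end.\<close>
    have "real (card (uminus ` U)) * (real (card (uminus ` U)) + 1) / 2
        \<le> (\<Sum>x\<in>uminus ` U. real_of_int (- a - 1 + 1 - x))"
    proof (rule sum_distances_ge)
      show "x \<le> - a - 1" if "x \<in> uminus ` U" for x using that ne by (force simp: U_def)
    qed (use fin in simp)
    then have "real (card U) * (real (card U) + 1) / 2 \<le> (\<Sum>x\<in>U. real_of_int (x - a))"
      by (simp add: card_image sum.reindex)
    also have "\<dots> = (\<Sum>(i, j)\<in>(\<lambda>x. (a, x)) ` U. real_of_int (j - i))"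
      by (subst sum.reindex) (auto simp: inj_on_def)
    also have "\<dots> \<le> inversion_length S"
      using ne ab(1) by (intro sum_le_potential[OF S]) (force simp: inversions_def U_def)+
    finally show ?thesis by (simp add: power2_eq_square algebra_simps add_divide_distrib)
  qed
  have Z: "real (card Z) ^ 2 \<le> 2 * inversion_length S"
  proof -
    have ne: "x \<noteq> b" if "x \<in> Z" for x using that ab(2) by (auto simp: Z_def)
    have "real (card Z) * (real (card Z) + 1) / 2 \<le> (\<Sum>x\<in>Z. real_of_int (b - 1 + 1 - x))"
    proof (rule sum_distances_ge)
      show "x \<le> b - 1" if "x \<in> Z" for x using that ne by (force simp: Z_def)
    qed (use fin in simp)
    also have "\<dots> = (\<Sum>(i, j)\<in>(\<lambda>x. (x, b)) ` Z. real_of_int (j - i))"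
      by (subst sum.reindex) (auto simp: inj_on_def)
    also have "\<dots> \<le> inversion_length S"
      using ne ab(2) by (intro sum_le_potential[OF S]) (force simp: inversions_def Z_def)+
    finally show ?thesis by (simp add: power2_eq_square algebra_simps add_divide_distrib)
  qed
  have "real ((\<Sum>B\<in>finite_blocks False S. card B) + (\<Sum>B\<in>finite_blocks True S. card B)) ^ 2
      \<le> (real (card Z) + real (card U)) ^ 2"
    using sum_card_finite_blocks_le[of a S b False, OF ab(3,4)]
      sum_card_finite_blocks_le[of a S b True, OF ab(3,4)]
    unfolding Z_def[symmetric] U_def[symmetric] by (intro power_mono) linarith+
  also have "\<dots> \<le> 2 * (real (card Z) ^ 2 + real (card U) ^ 2)"
    using sum_squares_bound[of "real (card Z)" "real (card U)"] by (simp add: power2_sum)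
  also have "\<dots> \<le> 2 * (2 * inversion_length S + 2 * inversion_length S)"
    by (intro mult_left_mono add_mono Z U) simp
  finally show ?thesis by simp
qed

section \<open>Translation classes\<close>

lemma potential_shift: "potential w (\<lambda>x. S (x + k)) = potential w S"
proof -
  have eq: "inversions S = (\<lambda>(i, j). (i + k, j + k)) ` inversions (\<lambda>x. S (x + k))"
  proof (intro equalityI subsetI)
    fix z assume "z \<in> inversions S"
    then show "z \<in> (\<lambda>(i, j). (i + k, j + k)) ` inversions (\<lambda>x. S (x + k))"
      by (intro image_eqI[of _ _ "(fst z - k, snd z - k)"]) (auto simp: inversions_def)
  qed (auto simp: inversions_def)
  show ?thesis
    unfolding potential_def eq
    by (subst sum.reindex) (auto simp: inj_on_def case_prod_unfold intro!: sum.cong)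
qed

lift_definition config_potential :: "(int \<Rightarrow> real) \<Rightarrow> config \<Rightarrow> real" is potential
  by (auto simp: translates_def potential_shift simp flip: fun_eq_iff)

lemma config_cases:
  obtains S where "c = abs_config S" "admissible S" "translates S S"
  using Quotient_abs_rep[OF Quotient_config, of c] Quotient_rep_reflp[OF Quotient_config, of c]
  by (metis translates_def)

text \<open>Translation invariance moves the drift bounds from labellings to their translation classes.\<close>

lemma config_drift:
  assumes w: "\<And>d. 0 < d \<Longrightarrow> 0 \<le> w d"
    and drift: "\<And>S. admissible S \<Longrightarrow>
      measure_pmf.expectation (labelling_step \<beta> p S) (potential w) \<le> potential w S + C"
  shows "(\<integral>\<^sup>+d. ennreal (config_potential w d) \<partial>step \<beta> p c) \<le> ennreal (config_potential w c + C)"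
proof -
  obtain S where c: "c = abs_config S" and S: "admissible S" "translates S S"
    by (rule config_cases)
  have "translates T T" if "T \<in> set_pmf (labelling_step \<beta> p S)" for T
    using admissible_labelling_step[OF S(1) that] unfolding translates_def
    by (auto intro: exI[of _ 0])
  then have "(\<integral>\<^sup>+d. ennreal (config_potential w d) \<partial>step \<beta> p c) =
      (\<integral>\<^sup>+T. ennreal (potential w T) \<partial>labelling_step \<beta> p S)"
    unfolding c step.abs_eq[OF S(2)] nn_integral_map_pmf
    by (intro nn_integral_cong_AE) (auto simp: AE_measure_pmf_iff config_potential.abs_eq)
  also have "\<dots> = ennreal (measure_pmf.expectation (labelling_step \<beta> p S) (potential w))"
    by (intro nn_integral_eq_integral integrable_measure_pmf_finite
        finite_set_labelling_step[OF S(1)]) (simp add: potential_nonneg[OF w])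
  also have "\<dots> \<le> ennreal (potential w S + C)"
    by (intro ennreal_leI drift S)
  finally show ?thesis by (simp add: c config_potential.abs_eq[OF S(2)])
qed

lemma config_potential_nonneg:
  "(\<And>d. 0 < d \<Longrightarrow> 0 \<le> w d) \<Longrightarrow> 0 \<le> config_potential w c"
  by (rule config_cases[of c]) (simp add: config_potential.abs_eq potential_nonneg)

text \<open>A labelling is determined by its label at the origin and by its two finite sets of deviations
  from the ground state.\<close>

instance config :: countable
proof
  define enc where "enc S = ({x. x < 0 \<and> \<not> S x}, {x. 0 < x \<and> S x}, S 0)" for S :: labelling
  have "inj_on enc {S. admissible S}"
  proof (rule inj_onI)
    fix S T assume "enc S = enc T"
    then have *: "x < 0 \<Longrightarrow> S x = T x" "0 < x \<Longrightarrow> S x = T x" "S 0 = T 0" for x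
      unfolding enc_def by blast+
    show "S = T"
    proof
      fix x show "S x = T x" using * by (cases x "0 :: int" rule: linorder_cases) auto
    qed
  qed
  moreover have "enc ` {S. admissible S} \<subseteq> {A. finite A} \<times> {A. finite A} \<times> UNIV"
    by (auto simp: enc_def admissible_def)
  moreover have "countable ({A :: int set. finite A} \<times> {A :: int set. finite A} \<times> (UNIV :: bool set))"
    by (intro countable_SIGMA countable_Collect_finite) auto
  ultimately have "countable {S. admissible S}"
    by (meson countable_image_inj_on countable_subset)
  then have "countable (abs_config ` {S. admissible S})" by (rule countable_image)
  moreover have "abs_config ` {S. admissible S} = UNIV"
    using config_cases by blast
  ultimately have "countable (UNIV :: config set)" by simp
  then show "\<exists>f :: config \<Rightarrow> nat. inj f" unfolding countable_def .
qed

section \<open>Growth of the hybrid zone\<close>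

lemma num_blocks_square_le: "1 / 2 * real (num_blocks c) ^ 2 \<le> config_potential (\<lambda>d. 1) c"
  by (rule config_cases[of c])
    (simp only: num_blocks.abs_eq config_potential.abs_eq inversion_count_ge)

lemma num_blocks_cube_le: "1 / 6 * real (num_blocks c) ^ 3 \<le> config_potential real_of_int c"
  by (rule config_cases[of c])
    (simp only: num_blocks.abs_eq config_potential.abs_eq inversion_length_ge_cube)

lemma zone_size_square_le: "1 / 8 * real (zone_size c) ^ 2 \<le> config_potential real_of_int c"
  by (rule config_cases[of c])
    (simp only: zone_size.abs_eq config_potential.abs_eq inversion_length_ge_square)

theorem theorem7:
  fixes M :: "'w measure" and \<beta> p :: real and S\<^sub>0 :: config
    and \<xi> :: "nat \<Rightarrow> 'w \<Rightarrow> config"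
  assumes "\<beta> \<in> {0..1}" and "p \<in> {0..1}"
    and "exclusion_voter_process M \<beta> p S\<^sub>0 \<xi>"
  shows "(\<forall>\<epsilon>>0. AE \<omega> in M. \<forall>\<^sub>\<infinity>t.
      real (MAX s\<in>{0..t}. num_blocks (\<xi> s \<omega>)) \<le>
        (if p < 1/2 then real t powr (1/2) * ln (real t) powr (1/2 + \<epsilon>)
         else real t powr (1/3) * ln (real t) powr (1/3 + \<epsilon>))) \<and>
    (p \<in> {1/2..1} \<longrightarrow> (\<forall>\<epsilon>>0. AE \<omega> in M. \<forall>\<^sub>\<infinity>t.
      real (MAX s\<in>{0..t}. zone_size (\<xi> s \<omega>)) \<le>
        real t powr (1/2) * ln (real t) powr (1/2 + \<epsilon>)))"
proof -
  interpret exclusion_voter_process M \<beta> p S\<^sub>0 \<xi> by (rule assms(3))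
  interpret countable_markov_chain M "step \<beta> p" S\<^sub>0 \<xi>
    using random_variable_\<xi> initial markov by unfold_locales auto
  have count_drift: "(\<integral>\<^sup>+d. ennreal (config_potential (\<lambda>d. 1) d) \<partial>step \<beta> p c)
      \<le> ennreal (config_potential (\<lambda>d. 1) c + 1)" for c
    by (intro config_drift inversion_count_drift assms) auto
  have length_drift: "(\<integral>\<^sup>+d. ennreal (config_potential real_of_int d) \<partial>step \<beta> p c)
      \<le> ennreal (config_potential real_of_int c + 1)" if "1/2 \<le> p" for c
    using that assms(2) by (intro config_drift inversion_length_drift assms) auto
  note pos = config_potential_nonneg
  have blocks_square: "AE \<omega> in M. \<forall>\<^sub>\<infinity>t. real (MAX s\<in>{0..t}. num_blocks (\<xi> s \<omega>)) \<le>
      real t powr (1/2) * ln (real t) powr (1/2 + \<epsilon>)" if "0 < \<epsilon>" for \<epsilon>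
    using AE_running_max_le[OF pos _ count_drift _ num_blocks_square_le _ that] by simp
  have blocks_cube: "AE \<omega> in M. \<forall>\<^sub>\<infinity>t. real (MAX s\<in>{0..t}. num_blocks (\<xi> s \<omega>)) \<le>
      real t powr (1/3) * ln (real t) powr (1/3 + \<epsilon>)" if "0 < \<epsilon>" "1/2 \<le> p" for \<epsilon>
    using AE_running_max_le[OF pos _ length_drift _ num_blocks_cube_le _ that(1)] that(2) by simp
  have zone: "AE \<omega> in M. \<forall>\<^sub>\<infinity>t. real (MAX s\<in>{0..t}. zone_size (\<xi> s \<omega>)) \<le>
      real t powr (1/2) * ln (real t) powr (1/2 + \<epsilon>)" if "0 < \<epsilon>" "1/2 \<le> p" for \<epsilon>
    using AE_running_max_le[OF pos _ length_drift _ zone_size_square_le _ that(1)] that(2) by simp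
  show ?thesis
    using blocks_square blocks_cube zone by (cases "p < 1/2") auto
qed

end
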